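(* Let $\tilde G\colon[0,\infty)\to(0,\infty)$ be continuous and strictly increasing with $\lim_{r\to\infty}\tilde G(r)=\infty$. Then there exist an entire function $\varphi$ and $R_0>0$ such that $$\log\log M(r,\varphi)<\tilde G(r)\log r\qquad\text{for all } r>R_0,$$ and such that every $w\in\overline{\mathbb C}=\mathbb C\cup\{\infty\}$ is an asymptotic value of $\varphi$.
   Context: For an entire function $f$, $M(r,f)=\max\{|f(z)|:|z|=r\}$. A point $w\in\overline{\mathbb C}$ is an asymptotic value of $f$ if there is a path $\gamma$ from $0$ to $\infty$ such that $f(z)\to w$ as $z\to\infty$ along $\gamma$. *)

theory Defs
  imports "HOL-Complex_Analysis.Complex_Analysis"
begin

definition max_modulus :: "(complex \<Rightarrow> complex) \<Rightarrow> real \<Rightarrow> real" where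
  "max_modulus f r = (SUP z\<in>sphere 0 r. cmod (f z))"

definition path_to_infinity :: "(real \<Rightarrow> complex) \<Rightarrow> bool" where
  "path_to_infinity \<gamma> \<longleftrightarrow> continuous_on {0..} \<gamma> \<and> \<gamma> 0 = 0 \<and>
     filterlim \<gamma> at_infinity at_top"

definition asymptotic_value :: "(complex \<Rightarrow> complex) \<Rightarrow> complex \<Rightarrow> bool" where
  "asymptotic_value f w \<longleftrightarrow>
     (\<exists>\<gamma>. path_to_infinity \<gamma> \<and> ((\<lambda>t. f (\<gamma> t)) \<longlongrightarrow> w) at_top)"

definition asymptotic_value_infinity :: "(complex \<Rightarrow> complex) \<Rightarrow> bool" where
  "asymptotic_value_infinity f \<longleftrightarrow>
     (\<exists>\<gamma>. path_to_infinity \<gamma> \<and> filterlim (\<lambda>t. f (\<gamma> t)) at_infinity at_top)"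

end

theory Submission
  imports Defs "HOL-Real_Asymp.Real_Asymp"
begin

text \<open>
  The function is \<open>\<phi>(z) = (\<Sum>n. F ((z / R n) ^ (100 ^ n)) / (n + 1))\<close> with \<open>F\<close> the primitive of
  \<open>exp (- z ^ 4)\<close> vanishing at \<open>0\<close> and radii \<open>R n\<close> growing very fast. In thin sectors around the four
  directions \<open>\<i> ^ b\<close>, \<open>F\<close> tends to \<open>\<i> ^ b * L\<close> with \<open>L \<noteq> 0\<close>. If \<open>2 \<theta> / \<pi>\<close> has the base 100 digits
  \<open>b n \<in> {0, 1, 2, 3}\<close>, then along the ray of argument \<open>\<theta>\<close> the \<open>n\<close>-th power has argument close to
  that of \<open>\<i> ^ b n\<close> for every \<open>n\<close>. Hence \<open>\<phi>\<close> follows on this ray the partial sums of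
  \<open>L * (\<Sum>n. \<i> ^ b n / (n + 1))\<close>; only the summand in transition is not controlled by decay, and its
  coefficient tends to \<open>0\<close>. As the harmonic series diverges, a greedy choice of digits reaches every
  complex number, and constant digits reach infinity. Near radius \<open>r\<close> only the first \<open>n\<close> summands matter,
  so \<open>log log M(r, \<phi>)\<close> is about \<open>4 * 100 ^ n * log r\<close>, and \<open>R n\<close> may be chosen so large that this
  stays below \<open>G(r) * log r\<close>.
\<close>

section \<open>Signed sums\<close>

text \<open>Greedy choice: \<open>e n\<close> is what is still missing after \<open>n\<close> terms,
  and each sign points towards it. Divergence of the series forces
  \<open>\<bar>e N\<bar> \<le> c N\<close> at arbitrarily late \<open>N\<close>, and monotonicity of
  \<open>c\<close> keeps the remainder below that bound afterwards.\<close>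

lemma signed_sum_tendsto:
  fixes c :: "nat \<Rightarrow> real" and x :: real
  assumes nn: "\<And>n. c n \<ge> 0" and dec: "decseq c" and c0: "c \<longlonglongrightarrow> 0"
    and div: "\<not> summable c"
  obtains s :: "nat \<Rightarrow> real" where "\<And>n. s n = 1 \<or> s n = -1"
    "(\<lambda>N. \<Sum>n<N. c n * s n) \<longlonglongrightarrow> x"
proof -
  define sg where "sg = (\<lambda>y::real. if y \<ge> 0 then 1 else (-1::real))"
  define e where "e = rec_nat x (\<lambda>n y. y - c n * sg y)"
  have e_0: "e 0 = x" and e_Suc: "\<And>n. e (Suc n) = e n - c n * sg (e n)"
    by (simp_all add: e_def)
  have abs_Suc: "\<bar>e (Suc n)\<bar> = \<bar>\<bar>e n\<bar> - c n\<bar>" for n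
    unfolding e_Suc sg_def by (auto simp: abs_if)
  have sum_e: "(\<Sum>n<N. c n * sg (e n)) = x - e N" for N
    by (induction N) (simp_all add: e_0 e_Suc)
  \<comment> \<open>Otherwise the remainder would shrink by the full \<open>c n\<close> at every
    step from \<open>M\<close> on, which would bound the partial sums.\<close>
  have small: "\<exists>N\<ge>M. \<bar>e N\<bar> \<le> c N" for M
  proof (rule ccontr)
    assume "\<not> ?thesis"
    then have gt: "\<bar>e N\<bar> > c N" if "N \<ge> M" for N
      using that by (meson not_le)
    have tel: "\<bar>e (M + k)\<bar> = \<bar>e M\<bar> - (\<Sum>i<k. c (i + M))" for k
    proof (induction k)
      case (Suc k)
      have "\<bar>e (M + Suc k)\<bar> = \<bar>e (M + k)\<bar> - c (M + k)"
        using abs_Suc[of "M + k"] gt[of "M + k"] by simp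
      then show ?case using Suc by (simp add: add.commute)
    qed simp
    have "summable (\<lambda>i. c (i + M))"
    proof (rule summableI_nonneg_bounded[where x = "\<bar>e M\<bar>"])
      show "(\<Sum>i<k. c (i + M)) \<le> \<bar>e M\<bar>" for k
        using tel[of k] abs_ge_zero[of "e (M + k)"] by linarith
    qed (rule nn)
    then show False using div summable_iff_shift by blast
  qed
  \<comment> \<open>Both \<open>\<bar>e n\<bar>\<close> and \<open>c n\<close> lie in the interval
    from 0 to \<open>c N\<close>, hence so does the modulus of their difference.\<close>
  have stay: "\<bar>e n\<bar> \<le> c N" if "\<bar>e N\<bar> \<le> c N" "n \<ge> N" for n N
    using that(2)
  proof (induction n rule: dec_induct)
    case (step n)
    have "c n \<le> c N" using dec step by (simp add: decseq_def)
    then show ?case using step nn[of n] abs_Suc[of n] by linarith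
  qed (rule that(1))
  have "e \<longlonglongrightarrow> 0"
  proof (rule LIMSEQ_I)
    fix r :: real assume "r > 0"
    then obtain M where M: "\<And>n. n \<ge> M \<Longrightarrow> \<bar>c n\<bar> < r"
      using LIMSEQ_D[OF c0, of r] by auto
    obtain N where "N \<ge> M" "\<bar>e N\<bar> \<le> c N" using small by blast
    then have "\<forall>n\<ge>N. norm (e n - 0) < r"
      using stay[of N] M[of N] by fastforce
    then show "\<exists>no. \<forall>n\<ge>no. norm (e n - 0) < r" by blast
  qed
  then have "(\<lambda>N. x - e N) \<longlonglongrightarrow> x"
    using tendsto_diff[OF tendsto_const, of e 0 sequentially x] by simp
  then have "(\<lambda>N. \<Sum>n<N. c n * sg (e n)) \<longlonglongrightarrow> x"
    by (simp add: sum_e)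
  then show thesis
    by (intro that[of "\<lambda>n. sg (e n)"]) (auto simp: sg_def)
qed

lemma not_summable_inverse_Suc: "\<not> summable (\<lambda>n. 1 / real (Suc n))"
  using not_summable_harmonic[where 'a = real]
  by (subst (asm) summable_Suc_iff[symmetric]) (simp add: inverse_eq_divide)

text \<open>The four values \<open>(1 + \<i>) * \<i> ^ b\<close> are exactly the numbers \<open>\<plusminus> 1 \<plusminus> \<i>\<close>, so that the real and the
  imaginary part of the sum can be steered independently.\<close>
lemma fourth_root_sum_tendsto:
  fixes w :: complex
  obtains b :: "nat \<Rightarrow> nat" where "\<And>n. b n \<le> 3"
    "(\<lambda>N. \<Sum>n<N. of_real (1 / real (Suc n)) * \<i> ^ b n) \<longlonglongrightarrow> w"
proof -
  define c where "c = (\<lambda>n. 1 / real (Suc n))"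
  have c: "\<And>n. c n \<ge> 0" "decseq c" "c \<longlonglongrightarrow> 0" "\<not> summable c"
    using not_summable_inverse_Suc
    by (auto simp: c_def decseq_def field_simps simp del: of_nat_Suc) real_asymp
  define v where "v = (1 + \<i>) * w"
  obtain s where s: "\<And>n. s n = 1 \<or> s n = -1" "(\<lambda>N. \<Sum>n<N. c n * s n) \<longlonglongrightarrow> Re v"
    using signed_sum_tendsto[OF c] by metis
  obtain t where t: "\<And>n. t n = 1 \<or> t n = -1" "(\<lambda>N. \<Sum>n<N. c n * t n) \<longlonglongrightarrow> Im v"
    using signed_sum_tendsto[OF c] by metis
  have "\<exists>k\<le>3. (1 + \<i>) * \<i> ^ k = Complex (s n) (t n)" for n
  proof -
    have "Complex (s n) (t n) \<in> (\<lambda>k. (1 + \<i>) * \<i> ^ k) ` {0, 1, 2, 3}"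
      using s(1)[of n] t(1)[of n] by (auto simp: complex_eq_iff power3_eq_cube)
    then obtain k where "k \<in> {0, 1, 2, 3}" "Complex (s n) (t n) = (1 + \<i>) * \<i> ^ k" by blast
    then show ?thesis by (intro exI[of _ k]) auto
  qed
  then obtain b where b: "\<And>n. b n \<le> 3" "\<And>n. (1 + \<i>) * \<i> ^ b n = Complex (s n) (t n)"
    by metis
  have "(\<lambda>N. Complex (\<Sum>n<N. c n * s n) (\<Sum>n<N. c n * t n)) \<longlonglongrightarrow> Complex (Re v) (Im v)"
    by (intro tendsto_Complex s t)
  also have "(\<lambda>N. Complex (\<Sum>n<N. c n * s n) (\<Sum>n<N. c n * t n)) =
      (\<lambda>N. (1 + \<i>) * (\<Sum>n<N. of_real (c n) * \<i> ^ b n))"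
  proof
    fix N
    have "(1 + \<i>) * (\<Sum>n<N. of_real (c n) * \<i> ^ b n) =
        (\<Sum>n<N. of_real (c n) * ((1 + \<i>) * \<i> ^ b n))"
      by (simp add: sum_distrib_left mult_ac)
    also have "\<dots> = Complex (\<Sum>n<N. c n * s n) (\<Sum>n<N. c n * t n)"
      by (simp add: b complex_eq_iff)
    finally show "Complex (\<Sum>n<N. c n * s n) (\<Sum>n<N. c n * t n) =
        (1 + \<i>) * (\<Sum>n<N. of_real (c n) * \<i> ^ b n)" ..
  qed
  finally have lim: "(\<lambda>N. (1 + \<i>) * (\<Sum>n<N. of_real (c n) * \<i> ^ b n)) \<longlonglongrightarrow> (1 + \<i>) * w"
    by (simp only: v_def complex_surj)
  have "1 + \<i> \<noteq> 0" by (simp add: complex_eq_iff)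
  then have "(\<lambda>N. \<Sum>n<N. of_real (c n) * \<i> ^ b n) \<longlonglongrightarrow> w"
    using tendsto_divide[OF lim tendsto_const, of "1 + \<i>"] by simp
  then show thesis by (intro that[OF b(1)]) (simp add: c_def)
qed

section \<open>The primitive of \<open>exp (- (z ^ 4))\<close>\<close>

text \<open>In the real part \<open>x ^ 4 - 6 * x\<^sup>2 * y\<^sup>2 + y ^ 4\<close> of the fourth
  power, the slope bound 1/4 limits the negative term to 3/8 of \<open>x ^ 4\<close>, which leaves
  more than half.\<close>

lemma quartic_sector_bound:
  fixes z :: complex
  assumes "\<bar>Im z\<bar> \<le> Re z / 4"
  shows "cmod (exp (- (z ^ 4))) \<le> exp (- (Re z ^ 4 / 2))"
proof -
  define x y where "x = Re z" and "y = Im z"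
  have "y\<^sup>2 \<le> (x / 4)\<^sup>2"
    using assms by (intro power2_le_iff_abs_le[THEN iffD2]) (auto simp: x_def y_def)
  then have "x\<^sup>2 * (6 * y\<^sup>2) \<le> x\<^sup>2 * (6 * (x / 4)\<^sup>2)"
    by (intro mult_left_mono) auto
  also have "\<dots> = 3 / 8 * x ^ 4" by (simp add: power2_eq_square power4_eq_xxxx)
  finally have "6 * x\<^sup>2 * y\<^sup>2 \<le> 3 / 8 * x ^ 4" by (simp only: mult_ac)
  moreover have "x ^ 4 \<ge> 0" "y ^ 4 \<ge> 0" by simp_all
  moreover have "Re (z ^ 4) = x ^ 4 - 6 * x\<^sup>2 * y\<^sup>2 + y ^ 4"
    by (simp add: x_def y_def power2_eq_square power4_eq_xxxx algebra_simps)
  ultimately have "- Re (z ^ 4) \<le> - (x ^ 4 / 2)" by linarith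
  then show ?thesis by (simp add: x_def)
qed

text \<open>The square terms cancel in the sum of squares, which equals
  \<open>x ^ 4 - 4 * x + 3\<close>. The inequality trades quartic decay for simple exponential
  decay, with one factor \<open>exp x\<close> to spare.\<close>

lemma quartic_le: "2 * x - x ^ 4 / 2 \<le> (2::real)"
proof -
  have "(x\<^sup>2 - 1)\<^sup>2 + 2 * (x - 1)\<^sup>2 \<ge> 0" by simp
  then show ?thesis by (simp add: power2_eq_square power4_eq_xxxx algebra_simps)
qed

locale quartic_primitive =
  fixes F :: "complex \<Rightarrow> complex"
  assumes deriv: "\<And>z. (F has_field_derivative exp (- (z ^ 4))) (at z)"
    and F_0: "F 0 = 0"
begin

text \<open>The linear factor, due to \<open>F 0 = 0\<close>, makes the summands small where their
  argument is small and so yields convergence of the series.\<close>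

lemma norm_le: "cmod (F z) \<le> cmod z * exp (cmod z ^ 4)"
proof -
  have "cmod (F z - F 0) \<le> exp (cmod z ^ 4) * cmod (z - 0)"
  proof (rule field_differentiable_bound[where S = "cball 0 (cmod z)"])
    fix y :: complex assume "y \<in> cball 0 (cmod z)"
    then have "cmod y ^ 4 \<le> cmod z ^ 4" by (intro power_mono) auto
    then have "cmod (- (y ^ 4)) \<le> cmod z ^ 4" by (simp add: norm_power)
    then show "cmod (exp (- (y ^ 4))) \<le> exp (cmod z ^ 4)"
      by (meson exp_le_cancel_iff norm_exp order_trans)
  qed (auto intro: has_field_derivative_at_within deriv)
  then show ?thesis by (simp add: F_0 mult.commute)
qed

text \<open>Since \<open>(\<i> * z) ^ 4 = z ^ 4\<close>, both sides have the same derivative, and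
  they agree at 0. Thus one sector around the positive axis controls all four directions.\<close>

lemma mult_ii: "F (\<i> * z) = \<i> * F z"
proof -
  have "\<exists>c. \<forall>z\<in>UNIV. F (\<i> * z) - \<i> * F z = c"
  proof (rule has_field_derivative_zero_constant)
    fix z :: complex
    have "((\<lambda>z. F (\<i> * z)) has_field_derivative exp (- ((\<i> * z) ^ 4)) * \<i>) (at z)"
      by (rule DERIV_chain2[OF deriv]) (auto intro!: derivative_eq_intros)
    then have "((\<lambda>z. F (\<i> * z) - \<i> * F z) has_field_derivative
        exp (- ((\<i> * z) ^ 4)) * \<i> - \<i> * exp (- (z ^ 4))) (at z)"
      by (intro DERIV_diff DERIV_cmult deriv)
    then show "((\<lambda>z. F (\<i> * z) - \<i> * F z) has_field_derivative 0) (at z within UNIV)"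
      by (simp add: power_mult_distrib)
  qed simp
  then show ?thesis
    by (metis F_0 UNIV_I diff_self eq_iff_diff_eq_0 mult_zero_right)
qed

lemma mult_ii_power: "F (\<i> ^ k * z) = \<i> ^ k * F z"
  by (induction k) (simp_all add: mult_ii mult.assoc)

lemma real_axis_diff:
  fixes x y :: real
  assumes "0 \<le> x" "x \<le> y"
  shows "cmod (F (of_real y) - F (of_real x)) \<le> exp 2 * exp (- x)"
proof (cases "x = y")
  case False
  then have "x < y" using assms by simp
  have "cmod (F (of_real y) - F (of_real x)) \<le> (- exp 2 * exp (- y)) - (- exp 2 * exp (- x))"
  proof (rule differentiable_bound_general[OF \<open>x < y\<close>,
        where f' = "\<lambda>t. exp (- (of_real t ^ 4))" and \<phi>' = "\<lambda>t. exp 2 * exp (- t)"])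
    fix t assume t: "x < t" "t < y"
    show "((\<lambda>a. F (of_real a)) has_vector_derivative exp (- (of_real t ^ 4))) (at t)"
      by (intro has_vector_derivative_real_field deriv)
    show "((\<lambda>a. - exp 2 * exp (- a)) has_vector_derivative exp 2 * exp (- t)) (at t)"
      by (auto intro!: derivative_eq_intros simp flip: has_real_derivative_iff_has_vector_derivative)
    have "cmod (exp (- (of_real t ^ 4))) \<le> exp (- (t ^ 4 / 2))"
      using quartic_sector_bound[of "of_real t"] t assms by simp
    also have "\<dots> \<le> exp (2 - t)"
      using quartic_le[of t] t assms by (subst exp_le_cancel_iff) linarith
    finally show "cmod (exp (- (of_real t ^ 4))) \<le> exp 2 * exp (- t)"
      by (simp add: exp_diff exp_minus field_simps)
  next
    have "continuous_on UNIV F"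
      using deriv by (meson DERIV_isCont continuous_at_imp_continuous_on)
    then show "continuous_on {x..y} (\<lambda>a. F (of_real a))"
      by (rule continuous_on_compose2) (auto intro: continuous_intros)
  qed (auto intro!: continuous_intros)
  moreover have "0 \<le> exp 2 * exp (- y)" by simp
  ultimately show ?thesis by linarith
qed simp

text \<open>\<open>L\<close> is the limit along the positive axis. A point of the sector is compared
  first with its projection to the axis and then with \<open>L\<close>, at a cost of
  \<open>exp 2 * exp (- Re z)\<close> each.\<close>

lemma sector_limit:
  obtains L where "L \<noteq> 0"
    "\<And>z. \<bar>Im z\<bar> \<le> Re z / 4 \<Longrightarrow> cmod (F z - L) \<le> 2 * exp 2 * exp (- Re z)"
proof -
  have e0: "((\<lambda>n. exp 2 * exp (- real n)) \<longlonglongrightarrow> 0)" by real_asymp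
  have "Cauchy (\<lambda>n. F (of_nat n))"
  proof (rule CauchyI)
    fix e :: real assume "e > 0"
    then obtain N where N: "exp 2 * exp (- real N) < e"
      using LIMSEQ_D[OF e0, of e] by fastforce
    have half: "cmod (F (of_nat m) - F (of_nat n)) < e" if "n \<ge> N" "m \<ge> n" for m n
    proof -
      have "cmod (F (of_nat m) - F (of_nat n)) \<le> exp 2 * exp (- real n)"
        using real_axis_diff[of "real n" "real m"] that by simp
      also have "\<dots> \<le> exp 2 * exp (- real N)" using that by simp
      finally show ?thesis using N by simp
    qed
    have "\<forall>m\<ge>N. \<forall>n\<ge>N. cmod (F (of_nat m) - F (of_nat n)) < e"
      by (metis half nle_le norm_minus_commute)
    then show "\<exists>M. \<forall>m\<ge>M. \<forall>n\<ge>M. cmod (F (of_nat m) - F (of_nat n)) < e" by blast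
  qed
  then obtain L where L: "(\<lambda>n. F (of_nat n)) \<longlonglongrightarrow> L"
    using Cauchy_convergent_iff convergent_def by metis
  have axis: "cmod (L - F (of_real x)) \<le> exp 2 * exp (- x)" if "x \<ge> 0" for x
  proof (rule tendsto_upperbound)
    show "(\<lambda>n. cmod (F (of_nat n) - F (of_real x))) \<longlonglongrightarrow> cmod (L - F (of_real x))"
      by (intro tendsto_intros L)
    show "\<forall>\<^sub>F n in sequentially. cmod (F (of_nat n) - F (of_real x)) \<le> exp 2 * exp (- x)"
      using eventually_ge_at_top[of "nat \<lceil>x\<rceil>"]
    proof eventually_elim
      case (elim n)
      then have "x \<le> real n" by linarith
      then show ?case using real_axis_diff[OF \<open>x \<ge> 0\<close>, of "real n"] by simp
    qed
  qed simp
  have inc: "Re (F (of_real x)) < Re (F (of_real y))" if "x < y" for x y :: real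
  proof (rule DERIV_pos_imp_increasing[OF that])
    fix t :: real
    have "((\<lambda>a. F (of_real a)) has_vector_derivative exp (- (of_real t ^ 4))) (at t)"
      by (intro has_vector_derivative_real_field deriv)
    then have "((\<lambda>a. Re (F (of_real a))) has_vector_derivative Re (exp (- (of_real t ^ 4)))) (at t)"
      by (rule bounded_linear.has_vector_derivative[OF bounded_linear_Re])
    moreover have "exp (- ((of_real t :: complex) ^ 4)) = of_real (exp (- (t ^ 4)))"
      by (simp add: exp_of_real[symmetric])
    ultimately show "\<exists>d. ((\<lambda>a. Re (F (of_real a))) has_real_derivative d) (at t) \<and> 0 < d"
      by (auto simp: has_real_derivative_iff_has_vector_derivative)
  qed
  \<comment> \<open>Limits preserve only weak inequalities; comparing with the value at 1 instead of
    0 leaves room for strict positivity.\<close>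
  have "Re (F (of_real 1)) \<le> Re L"
  proof (rule tendsto_lowerbound)
    show "(\<lambda>n. Re (F (of_nat n))) \<longlonglongrightarrow> Re L" by (intro tendsto_intros L)
    show "\<forall>\<^sub>F n in sequentially. Re (F (of_real 1)) \<le> Re (F (of_nat n))"
      using eventually_gt_at_top[of 1]
    proof eventually_elim
      case (elim n)
      then show ?case using inc[of 1 "real n"] by simp
    qed
  qed simp
  then have "Re L > 0" using inc[of 0 1] by (simp add: F_0)
  then have "L \<noteq> 0" by auto
  moreover have "cmod (F z - L) \<le> 2 * exp 2 * exp (- Re z)" if z: "\<bar>Im z\<bar> \<le> Re z / 4" for z
  proof -
    define x where "x = Re z"
    have x: "x \<ge> 0" using z by (simp add: x_def)
    \<comment> \<open>The segment is vertical, so the real part stays \<open>x\<close> and the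
      sector bound is the same all along it. Its length is at most \<open>x\<close>, hence at most
      \<open>exp x\<close>.\<close>
    have "cmod (F z - F (of_real x)) \<le> exp (- (x ^ 4 / 2)) * cmod (z - of_real x)"
    proof (rule field_differentiable_bound[where S = "closed_segment z (of_real x)"])
      fix u assume "u \<in> closed_segment z (of_real x)"
      then obtain q where q: "0 \<le> q" "q \<le> 1" "u = (1 - q) *\<^sub>R z + q *\<^sub>R of_real x"
        by (auto simp: in_segment)
      have "Re u = x" by (simp add: q(3) x_def algebra_simps)
      moreover have "\<bar>Im u\<bar> \<le> \<bar>Im z\<bar>"
        using q(1,2) by (simp add: q(3) abs_mult mult_left_le_one_le)
      ultimately show "cmod (exp (- (u ^ 4))) \<le> exp (- (x ^ 4 / 2))"
        using quartic_sector_bound[of u] z by (simp add: x_def)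
    qed (auto intro: has_field_derivative_at_within deriv)
    also have "z - of_real x = \<i> * of_real (Im z)" by (simp add: complex_eq_iff x_def)
    also have "exp (- (x ^ 4 / 2)) * cmod (\<i> * of_real (Im z)) \<le> exp (- (x ^ 4 / 2)) * exp x"
    proof (intro mult_left_mono)
      have "\<bar>Im z\<bar> \<le> x" using z by (simp add: x_def)
      also have "x \<le> exp x" using exp_ge_add_one_self[of x] by linarith
      finally show "cmod (\<i> * of_real (Im z)) \<le> exp x" by (simp add: norm_mult)
    qed simp
    also have "\<dots> \<le> exp (2 - x)"
      unfolding exp_add[symmetric] using quartic_le[of x] by (subst exp_le_cancel_iff) linarith
    finally have "cmod (F z - F (of_real x)) \<le> exp 2 * exp (- x)"
      by (simp add: exp_diff exp_minus field_simps)
    moreover have "cmod (F (of_real x) - L) \<le> exp 2 * exp (- x)"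
      using axis[OF x] by (simp add: norm_minus_commute)
    ultimately have "cmod ((F z - F (of_real x)) + (F (of_real x) - L))
        \<le> exp 2 * exp (- x) + exp 2 * exp (- x)"
      by (rule norm_triangle_mono)
    then show ?thesis by (simp add: x_def mult_ac)
  qed
  ultimately show thesis by (rule that)
qed

end

lemma quartic_primitive_exists: "\<exists>F. quartic_primitive F"
proof -
  have "(\<lambda>z::complex. exp (- (z ^ 4))) holomorphic_on UNIV" by (intro holomorphic_intros)
  then obtain g where g: "\<And>z::complex. (g has_field_derivative exp (- (z ^ 4))) (at z)"
    using holomorphic_convex_primitive'[OF convex_UNIV open_UNIV] by auto
  have "quartic_primitive (\<lambda>z. g z - g 0)"
    by standard (auto intro!: derivative_eq_intros g)
  then show ?thesis by blast
qed

section \<open>Rays with digits in base 100\<close>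

text \<open>The base 100 expansion shifted so that \<open>b n\<close> stands in front of the
  point.\<close>

definition digit_tail :: "(nat \<Rightarrow> nat) \<Rightarrow> nat \<Rightarrow> real" where
  "digit_tail b n = (\<Sum>m. real (b (n + m)) / 100 ^ m)"

context
  fixes b :: "nat \<Rightarrow> nat"
  assumes digits: "\<And>n. b n \<le> 3"
begin

lemma summable_digit_tail: "summable (\<lambda>m. real (b (n + m)) / 100 ^ m)"
proof (rule summable_comparison_test')
  show "summable (\<lambda>m. 3 * (1 / 100 :: real) ^ m)"
    by (intro summable_mult summable_geometric) simp
  show "norm (real (b (n + m)) / 100 ^ m) \<le> 3 * (1 / 100) ^ m" for m
    using digits[of "n + m"] by (simp add: power_one_over field_simps)
qed

lemma digit_tail_Suc: "digit_tail b n = real (b n) + digit_tail b (Suc n) / 100"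
proof -
  have "digit_tail b n = real (b n) + (\<Sum>m. real (b (n + Suc m)) / 100 ^ Suc m)"
    unfolding digit_tail_def by (subst suminf_split_head[OF summable_digit_tail]) simp
  also have "(\<Sum>m. real (b (n + Suc m)) / 100 ^ Suc m) = digit_tail b (Suc n) / 100"
    unfolding digit_tail_def
    by (subst suminf_divide[OF summable_digit_tail, symmetric]) (simp add: mult.commute)
  finally show ?thesis .
qed

lemma digit_tail_nonneg: "0 \<le> digit_tail b n"
  unfolding digit_tail_def by (intro suminf_nonneg summable_digit_tail) simp

lemma digit_tail_le: "digit_tail b n \<le> 4"
proof -
  have "digit_tail b n \<le> (\<Sum>m. 3 * (1 / 100 :: real) ^ m)"
    unfolding digit_tail_def
  proof (intro suminf_le summable_digit_tail summable_mult summable_geometric)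
    show "real (b (n + m)) / 100 ^ m \<le> 3 * (1 / 100) ^ m" for m
      using digits[of "n + m"] by (simp add: power_one_over field_simps)
  qed simp
  also have "\<dots> = 3 * (100 / 99)"
    by (subst suminf_mult) (auto simp: suminf_geometric)
  finally show ?thesis by simp
qed

text \<open>Taking the 100th power shifts the expansion by one digit. The digit moved out
  contributes \<open>100 * (pi / 2) * b n\<close>, that is \<open>25 * b n\<close> full
  turns.\<close>

lemma cis_digit_tail: "cis (pi / 2 * digit_tail b 0) ^ (100 ^ n) = cis (pi / 2 * digit_tail b n)"
proof (induction n)
  case (Suc n)
  have "cis (pi / 2 * digit_tail b 0) ^ (100 ^ Suc n) = cis (pi / 2 * digit_tail b n) ^ 100"
    by (simp only: power_Suc2 power_mult Suc)
  also have "\<dots> = cis (2 * pi * real (25 * b n) + pi / 2 * digit_tail b (Suc n))"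
    unfolding Complex.DeMoivre by (rule arg_cong[of _ _ cis]) (simp add: digit_tail_Suc[of n] algebra_simps)
  also have "\<dots> = cis (pi / 2 * digit_tail b (Suc n))"
    unfolding cis_mult[symmetric] by (subst cis_multiple_2pi) auto
  finally show ?case .
qed simp

lemma ray_power_sector:
  obtains v where "cis (pi / 2 * digit_tail b 0) ^ (100 ^ n) = \<i> ^ b n * v"
    "Re v \<ge> 1 / 2" "\<bar>Im v\<bar> \<le> Re v / 4"
proof
  \<comment> \<open>The angle contributed by the digits after \<open>b n\<close>. It is at most
    1/10, so the sine is at most 1/10 while a quarter of the cosine is at least 1/8.\<close>
  define d where "d = pi / 2 * (digit_tail b (Suc n) / 100)"
  have root: "cis (pi / 2 * real (b n)) = \<i> ^ b n"
    unfolding cis_pi_half[symmetric] Complex.DeMoivre by (rule arg_cong[of _ _ cis]) simp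
  have "pi / 2 * digit_tail b n = pi / 2 * real (b n) + d"
    by (simp add: digit_tail_Suc[of n] d_def algebra_simps)
  then show "cis (pi / 2 * digit_tail b 0) ^ (100 ^ n) = \<i> ^ b n * cis d"
    by (simp only: cis_digit_tail cis_mult[symmetric] root)
  have d0: "0 \<le> d" using digit_tail_nonneg by (simp add: d_def)
  have "d \<le> 4 / 2 * (4 / 100)"
    unfolding d_def using digit_tail_le[of "Suc n"] digit_tail_nonneg[of "Suc n"] pi_less_4 
    by (intro mult_mono) auto
  then have d1: "d \<le> 1 / 10" by simp
  have "sin d \<le> d" using d0 by (rule sin_x_le_x)
  moreover have "sin d \<ge> 0" using d0 d1 pi_gt3 by (intro sin_ge_zero) auto
  ultimately have s: "\<bar>sin d\<bar> \<le> 1 / 10" using d1 by simp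
  have "cos (pi / 3) \<le> cos d" using d0 d1 pi_gt3 by (intro cos_monotone_0_pi_le) auto
  then have c: "cos d \<ge> 1 / 2" by (simp add: cos_60)
  show "Re (cis d) \<ge> 1 / 2" "\<bar>Im (cis d)\<bar> \<le> Re (cis d) / 4"
    using s c by auto
qed

end

lemma path_to_infinity_ray: "path_to_infinity (\<lambda>t. of_real t * cis a)"
  unfolding path_to_infinity_def
proof (intro conjI)
  show "filterlim (\<lambda>t. of_real t * cis a) at_infinity at_top"
    by (rule filterlim_norm_at_top_imp_at_infinity) (simp add: norm_mult filterlim_abs_real)
qed (auto intro!: continuous_intros)

lemma filterlim_sum_at_top:
  fixes c :: "nat \<Rightarrow> real"
  assumes "\<And>n. c n \<ge> 0" "\<not> summable c"
  shows "filterlim (\<lambda>N. \<Sum>n<N. c n) at_top sequentially"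
  unfolding filterlim_at_top
proof
  fix Z
  have "\<exists>N. (\<Sum>n<N. c n) \<ge> Z"
    using summableI_nonneg_bounded[of c Z] assms by (meson nle_le)
  then obtain N where N: "(\<Sum>n<N. c n) \<ge> Z" ..
  show "\<forall>\<^sub>F N in sequentially. Z \<le> (\<Sum>n<N. c n)"
    using eventually_ge_at_top[of N]
  proof eventually_elim
    case (elim M)
    then have "(\<Sum>n<N. c n) \<le> (\<Sum>n<M. c n)" using assms by (intro sum_mono2) auto
    then show ?case using N by linarith
  qed
qed

section \<open>The lacunary sum\<close>

text \<open>\<open>R_ge\<close> makes the radii outgrow \<open>n\<close>, so that each disc meets
  only finitely many large summands and a factor such as \<open>n + 4\<close> is absorbed by the
  modulus. \<open>R_Suc\<close> ensures that at modulus \<open>R n / 2\<close> every earlier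
  quotient \<open>cmod z / R m\<close> is at least \<open>n\<close>.\<close>

locale lacunary_sum = quartic_primitive +
  fixes L :: complex and R :: "nat \<Rightarrow> real"
  assumes L_nonzero: "L \<noteq> 0"
    and sector: "\<And>z. \<bar>Im z\<bar> \<le> Re z / 4 \<Longrightarrow> cmod (F z - L) \<le> 2 * exp 2 * exp (- Re z)"
    and R_ge: "\<And>n. R n \<ge> 2 * (real n + 6)"
    and R_Suc: "\<And>n. R (Suc n) \<ge> 2 * real (Suc n) * R n"
begin

definition summand :: "nat \<Rightarrow> complex \<Rightarrow> complex" where
  "summand n z = of_real (1 / real (Suc n)) * F ((z / of_real (R n)) ^ (100 ^ n))"

definition lsum :: "complex \<Rightarrow> complex" where
  "lsum z = (\<Sum>n. summand n z)"

lemma R_pos: "R n > 0"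
  by (rule less_le_trans[OF _ R_ge]) simp

lemma R_less_Suc: "R n < R (Suc n)"
proof -
  have "1 * R n < 2 * real (Suc n) * R n"
    using R_pos[of n] by (intro mult_strict_right_mono) auto
  then show ?thesis using R_Suc[of n] by simp
qed

lemma strict_mono_R: "strict_mono R"
  using R_less_Suc by (simp add: strict_mono_Suc_iff)

lemma R_ratio:
  assumes "m < n"
  shows "R n \<ge> 2 * real n * R m"
proof -
  obtain k where k: "n = Suc k" "m \<le> k" using assms by (cases n) auto
  have "R m \<le> R k" using k strict_mono_R by (simp add: strict_mono_less_eq)
  then have "2 * real n * R m \<le> 2 * real n * R k" by (intro mult_left_mono) auto
  also have "\<dots> \<le> R n" using R_Suc[of k] by (simp only: k)
  finally show ?thesis .
qed

section \<open>Estimates for the summands, convergence and growth of the sum\<close>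

lemma norm_power_quotient: "cmod ((z / of_real (R n)) ^ k) = (cmod z / R n) ^ k"
  using R_pos[of n] by (simp add: norm_power norm_divide)

lemma norm_summand_le: "cmod (summand n z) \<le> cmod (F ((z / of_real (R n)) ^ (100 ^ n)))"
proof -
  have "1 / real (Suc n) \<le> 1" by simp
  then show ?thesis
    unfolding summand_def norm_mult norm_of_real by (intro mult_left_le_one_le) auto
qed

lemma norm_summand_small:
  assumes "cmod z \<le> R n / 2"
  shows "cmod (summand n z) \<le> 3 * (1 / 2) ^ n"
proof -
  define s where "s = (z / of_real (R n)) ^ (100 ^ n)"
  have q: "cmod z / R n \<le> 1 / 2" using assms R_pos[of n] by (simp add: field_simps)
  have "cmod s \<le> (1 / 2) ^ (100 ^ n)"
    unfolding s_def norm_power_quotient using q R_pos[of n] by (intro power_mono) auto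
  also have "\<dots> \<le> (1 / 2 :: real) ^ n"
    \<comment> \<open>The exponents compare by \<open>n \<le> 2 ^ n \<le> 100 ^ n\<close>.\<close>
    by (intro power_decreasing order.trans[OF less_imp_le[OF less_exp] power_mono]) auto
  finally have s: "cmod s \<le> (1 / 2) ^ n" .
  also have "\<dots> \<le> 1" by (simp add: power_le_one)
  finally have "cmod s ^ 4 \<le> 1" by (simp add: power_le_one)
  then have "exp (cmod s ^ 4) \<le> exp 1" by simp
  then have "exp (cmod s ^ 4) \<le> 3" using exp_le by linarith
  then have "cmod s * exp (cmod s ^ 4) \<le> (1 / 2) ^ n * 3"
    using s by (intro mult_mono) auto
  then show ?thesis using norm_summand_le[of n z] norm_le[of s] by (simp add: s_def)
qed

text \<open>With \<open>s\<close> the argument of \<open>F\<close>, the factor \<open>cmod s\<close>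
  in \<open>norm_le\<close> is at most \<open>exp (cmod s ^ 4)\<close>, which doubles the exponent.
  Division by \<open>R m \<ge> 1\<close> only helps and is dropped.\<close>

lemma norm_summand_growth:
  assumes "1 \<le> cmod z" "m \<le> n"
  shows "cmod (summand m z) \<le> exp (2 * cmod z ^ (4 * 100 ^ n))"
proof -
  define s where "s = (z / of_real (R m)) ^ (100 ^ m)"
  define X where "X = cmod z ^ (4 * 100 ^ n)"
  have "cmod z / R m \<le> cmod z"
    using R_ge[of m] divide_left_mono[of 1 "R m" "cmod z"] by simp
  then have "cmod s \<le> cmod z ^ (100 ^ m)"
    unfolding s_def norm_power_quotient using R_pos[of m] by (intro power_mono) auto
  then have "cmod s ^ 4 \<le> (cmod z ^ (100 ^ m)) ^ 4" by (intro power_mono) auto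
  also have "\<dots> = cmod z ^ (4 * 100 ^ m)" by (simp add: power_mult[symmetric] mult.commute)
  also have "\<dots> \<le> X" unfolding X_def using assms by (intro power_increasing) auto
  finally have X: "cmod s ^ 4 \<le> X" .
  have "cmod s \<le> 1 + cmod s ^ 4"
  proof (cases "cmod s \<le> 1")
    case False
    then have "cmod s ^ 1 \<le> cmod s ^ 4" by (intro power_increasing) auto
    then show ?thesis by simp
  qed (simp add: add_increasing2)
  also have "\<dots> \<le> exp (cmod s ^ 4)" by (rule exp_ge_add_one_self)
  finally have "cmod s * exp (cmod s ^ 4) \<le> exp (cmod s ^ 4) * exp (cmod s ^ 4)"
    by (intro mult_right_mono) auto
  also have "\<dots> \<le> exp X * exp X" using X by (intro mult_mono) auto
  also have "\<dots> = exp (2 * X)" by (simp flip: exp_add)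
  finally show ?thesis
    using norm_summand_le[of m z] norm_le[of s] by (simp add: s_def X_def)
qed

lemma eventually_norm_summand_small:
  "eventually (\<lambda>n. \<forall>z\<in>cball 0 r. cmod (summand n z) \<le> 3 * (1 / 2) ^ n) sequentially"
  using eventually_ge_at_top[of "nat \<lceil>r\<rceil>"]
proof eventually_elim
  case (elim n)
  then have "r \<le> real n" by linarith
  then have "r \<le> R n / 2" using R_ge[of n] by simp
  then show ?case using norm_summand_small by auto
qed

lemma summable_majorant: "summable (\<lambda>n. 3 * (1 / 2 :: real) ^ n)"
  by (intro summable_mult summable_geometric) simp

lemma summable_summand: "summable (\<lambda>n. summand n z)"
proof (rule summable_comparison_test_ev[OF _ summable_majorant])
  show "\<forall>\<^sub>F n in sequentially. norm (summand n z) \<le> 3 * (1 / 2) ^ n"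
    using eventually_norm_summand_small[of "cmod z"] by eventually_elim auto
qed

lemma summand_differentiable: "summand n field_differentiable (at z)"
proof -
  have "F holomorphic_on UNIV"
    using deriv by (auto simp: holomorphic_on_def field_differentiable_def intro: has_field_derivative_at_within)
  then have "(F \<circ> (\<lambda>z. (z / of_real (R n)) ^ (100 ^ n))) holomorphic_on UNIV"
    using R_pos[of n] by (intro holomorphic_on_compose_gen[of _ UNIV _ UNIV] holomorphic_intros) auto
  then have "summand n holomorphic_on UNIV"
    unfolding summand_def[abs_def] by (intro holomorphic_intros) (simp add: o_def)
  then show ?thesis by (simp add: holomorphic_on_def)
qed

text \<open>On each unit ball all but finitely many summands are dominated by one geometric series,
  so convergence is locally uniform.\<close>

lemma holomorphic_lsum: "lsum holomorphic_on UNIV"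
proof -
  obtain g where g: "\<forall>z\<in>UNIV. ((\<lambda>n. summand n z) sums g z) \<and> g field_differentiable (at z)"
  proof (rule series_differentiable_comparison_complex[OF open_UNIV])
    fix z :: complex
    have "\<forall>\<^sub>F n in sequentially. \<forall>y\<in>ball z 1 \<inter> UNIV.
        cmod (summand n y) \<le> cmod (of_real (3 * (1 / 2) ^ n))"
      using eventually_norm_summand_small[of "cmod z + 1"]
    proof eventually_elim
      case (elim n)
      have "y \<in> cball 0 (cmod z + 1)" if "y \<in> ball z 1" for y
        using that norm_triangle_ineq4[of z "z - y"] by (simp add: dist_norm)
      then show ?case using elim by (auto simp: norm_mult norm_power norm_divide)
    qed
    moreover have "summable (\<lambda>n. complex_of_real (3 * (1 / 2) ^ n))"
      by (intro summable_of_real summable_majorant)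
    ultimately show "\<exists>d h. 0 < d \<and> summable h \<and> range h \<subseteq> \<real>\<^sub>\<ge>\<^sub>0 \<and>
        (\<forall>\<^sub>F n in sequentially. \<forall>y\<in>ball z d \<inter> UNIV. cmod (summand n y) \<le> cmod (h n))"
      by (intro exI[of _ 1] exI[of _ "\<lambda>n. of_real (3 * (1 / 2) ^ n)"]) auto
  qed (auto intro: summand_differentiable)
  then have "lsum = g" by (auto simp: lsum_def sums_iff)
  then show ?thesis using g by (simp add: holomorphic_on_def)
qed

lemma lsum_tail:
  assumes "cmod z \<le> R (Suc n) / 2"
  shows "cmod (lsum z - (\<Sum>m<Suc n. summand m z)) \<le> 3 * (1 / 2) ^ n"
proof -
  have "lsum z - (\<Sum>m<Suc n. summand m z) = (\<Sum>m. summand (m + Suc n) z)"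
    unfolding lsum_def using suminf_split_initial_segment[OF summable_summand, of z "Suc n"] by simp
  also have "cmod \<dots> \<le> (\<Sum>m. 3 * (1 / 2) ^ Suc n * (1 / 2 :: real) ^ m)"
  proof (rule norm_suminf_le)
    fix m
    have "R (Suc n) \<le> R (m + Suc n)" using strict_mono_R by (simp add: strict_mono_less_eq)
    then have "cmod (summand (m + Suc n) z) \<le> 3 * (1 / 2) ^ (m + Suc n)"
      using assms by (intro norm_summand_small) simp
    then show "cmod (summand (m + Suc n) z) \<le> 3 * (1 / 2) ^ Suc n * (1 / 2) ^ m"
      by (simp only: power_add mult_ac)
  qed (intro summable_mult summable_geometric, simp)
  also have "\<dots> = 3 * (1 / 2) ^ n"
    by (subst suminf_mult) (auto simp: suminf_geometric)
  finally show ?thesis .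
qed

text \<open>The first \<open>n + 1\<close> summands are at most \<open>exp (2 * X)\<close> each and
  the tail is at most 3, giving \<open>(n + 4) * exp (2 * X)\<close>. As
  \<open>n + 6 \<le> r \<le> X\<close>, the factor is at most \<open>exp X\<close>, and
  \<open>3 * X \<le> r * X\<close> accounts for the extra 1 in the exponent.\<close>

lemma lsum_growth:
  assumes "R n / 2 \<le> cmod z" "cmod z \<le> R (Suc n) / 2"
  shows "cmod (lsum z) \<le> exp (cmod z ^ (4 * 100 ^ n + 1))"
proof -
  define r where "r = cmod z"
  define X where "X = r ^ (4 * 100 ^ n)"
  have r: "r \<ge> real n + 6" using assms(1) R_ge[of n] by (simp add: r_def)
  have "r ^ 1 \<le> X" unfolding X_def using r by (intro power_increasing) auto
  then have rX: "r \<le> X" by simp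
  have "cmod (\<Sum>m<Suc n. summand m z) \<le> of_nat (card {..<Suc n}) * exp (2 * X)"
  proof (rule order.trans[OF norm_sum sum_bounded_above])
    show "cmod (summand m z) \<le> exp (2 * X)" if "m \<in> {..<Suc n}" for m
      using norm_summand_growth[of z m n] that r by (simp add: X_def r_def)
  qed
  moreover have "3 * (1 / 2) ^ n \<le> (3::real) * 1" by (intro mult_left_mono power_le_one) auto
  moreover have "1 \<le> exp (2 * X)" using rX r by simp
  ultimately have "cmod (\<Sum>m<Suc n. summand m z) + 3 * (1 / 2) ^ n
      \<le> real (Suc n) * exp (2 * X) + 3 * exp (2 * X)"
    by (simp only: card_lessThan)
  also have "\<dots> = (real n + 4) * exp (2 * X)" by (simp add: algebra_simps)
  finally have "cmod (\<Sum>m<Suc n. summand m z) + 3 * (1 / 2) ^ n \<le> (real n + 4) * exp (2 * X)" .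
  then have "cmod (lsum z) \<le> (real n + 4) * exp (2 * X)"
    using lsum_tail[OF assms(2)]
      norm_triangle_ineq[of "lsum z - (\<Sum>m<Suc n. summand m z)" "\<Sum>m<Suc n. summand m z"] by simp
  also have "real n + 4 \<le> exp X"
    using r rX exp_ge_add_one_self[of X] by linarith
  then have "(real n + 4) * exp (2 * X) \<le> exp X * exp (2 * X)" by (intro mult_right_mono) auto
  also have "\<dots> = exp (3 * X)" by (simp flip: exp_add)
  also have "3 * X \<le> r * X" using r rX by (intro mult_right_mono) auto
  then have "exp (3 * X) \<le> exp (r ^ (4 * 100 ^ n + 1))" by (simp add: X_def)
  finally show ?thesis by (simp add: r_def)
qed

section \<open>Approximation by partial sums along the rays\<close>

definition ray_error :: "nat \<Rightarrow> real" where
  "ray_error n = real n * (2 * exp 2 * exp (- (real n / 2))) +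
     (cmod L + 2 * exp 2) / real (Suc n) + 3 * (1 / 2) ^ n"

lemma ray_error_tendsto: "ray_error \<longlonglongrightarrow> 0"
  unfolding ray_error_def by real_asymp

text \<open>The three terms of \<open>ray_error\<close> come from the summands before
  \<open>n\<close>, which have settled near their limits, from the \<open>n\<close>-th one, which is
  in transition, and from the tail. The partial sum stops before \<open>n\<close>, so the
  \<open>n\<close>-th summand counts as error in full.\<close>

lemma ray_approximation:
  assumes digits: "\<And>n. b n \<le> 3"
    and r: "R n / 2 \<le> r" "r \<le> R (Suc n) / 2"
  shows "cmod (lsum (of_real r * cis (pi / 2 * digit_tail b 0)) -
      L * (\<Sum>m<n. of_real (1 / real (Suc m)) * \<i> ^ b m)) \<le> ray_error n"
proof -
  define z where "z = of_real r * cis (pi / 2 * digit_tail b 0)"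
  define x where "x = (\<lambda>m. (r / R m) ^ (100 ^ m))"
  have r0: "r \<ge> 0" using r R_pos[of n] by linarith
  then have x0: "x m \<ge> 0" for m using R_pos[of m] by (simp add: x_def)
  have z: "cmod z = r" using r0 by (simp add: z_def norm_mult)
  \<comment> \<open>The factor \<open>\<i> ^ b m\<close> is pulled out of \<open>F\<close> by
    \<open>mult_ii_power\<close>. What remains is evaluated in the sector around the positive axis,
    at real part at least \<open>x m / 2\<close>.\<close>
  have "\<exists>u. summand m z = of_real (1 / real (Suc m)) * (\<i> ^ b m * u) \<and>
      cmod (u - L) \<le> 2 * exp 2 * exp (- (x m / 2))" for m
  proof -
    obtain v where v: "cis (pi / 2 * digit_tail b 0) ^ (100 ^ m) = \<i> ^ b m * v"
      "Re v \<ge> 1 / 2" "\<bar>Im v\<bar> \<le> Re v / 4"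
      using ray_power_sector[of b m, OF digits] by metis
    have "(z / of_real (R m)) ^ (100 ^ m) = \<i> ^ b m * (of_real (x m) * v)"
      unfolding x_def of_real_power of_real_divide power_divide z_def power_mult_distrib v(1) by simp
    then have "summand m z = of_real (1 / real (Suc m)) * (\<i> ^ b m * F (of_real (x m) * v))"
      by (simp only: summand_def mult_ii_power)
    moreover have "cmod (F (of_real (x m) * v) - L) \<le> 2 * exp 2 * exp (- (x m / 2))"
    proof -
      have "\<bar>Im (of_real (x m) * v)\<bar> \<le> Re (of_real (x m) * v) / 4"
        using mult_left_mono[OF v(3) x0[of m]] x0[of m] by (simp add: abs_mult)
      moreover have "x m / 2 \<le> Re (of_real (x m) * v)"
        using mult_left_mono[OF v(2) x0[of m]] by simp
      then have "2 * exp 2 * exp (- Re (of_real (x m) * v)) \<le> 2 * exp 2 * exp (- (x m / 2))"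
        by (intro mult_left_mono) auto
      ultimately show ?thesis using sector order.trans by blast
    qed
    ultimately show ?thesis by blast
  qed
  then obtain u where u: "\<And>m. summand m z = of_real (1 / real (Suc m)) * (\<i> ^ b m * u m)"
      "\<And>m. cmod (u m - L) \<le> 2 * exp 2 * exp (- (x m / 2))"
    by metis
  have old: "cmod (summand m z - L * (of_real (1 / real (Suc m)) * \<i> ^ b m))
      \<le> 2 * exp 2 * exp (- (real n / 2))" if "m < n" for m
  proof -
    have "real n \<le> r / R m"
      using R_ratio[OF that] r(1) R_pos[of m] by (simp add: field_simps)
    \<comment> \<open>Here \<open>m < n\<close> gives \<open>n \<ge> 1\<close>, so the base is at
      least 1 and its powers do not fall below it.\<close>
    also have "\<dots> \<le> x m"
      unfolding x_def using \<open>real n \<le> r / R m\<close> that by (intro self_le_power) auto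
    finally have decay: "2 * exp 2 * exp (- (x m / 2)) \<le> 2 * exp 2 * exp (- (real n / 2))" by simp
    have "summand m z - L * (of_real (1 / real (Suc m)) * \<i> ^ b m) =
        of_real (1 / real (Suc m)) * (\<i> ^ b m * (u m - L))"
      by (simp add: u(1) algebra_simps)
    also have "cmod \<dots> \<le> cmod (u m - L)"
      unfolding norm_mult norm_power norm_of_real by (simp add: divide_le_eq mult_le_cancel_left1)
    also have "\<dots> \<le> 2 * exp 2 * exp (- (x m / 2))" by (rule u(2))
    also note decay
    finally show ?thesis .
  qed
  have current: "cmod (summand n z) \<le> (cmod L + 2 * exp 2) / real (Suc n)"
  proof -
    \<comment> \<open>In transition \<open>x n\<close> may be anywhere from small to huge, but the
      sector estimate stays bounded; the smallness comes from the coefficient alone.\<close>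
    have "exp (- (x n / 2)) \<le> 1" using x0[of n] by simp
    then have "2 * exp 2 * exp (- (x n / 2)) \<le> 2 * exp 2 * (1::real)" by (intro mult_left_mono) auto
    then have "cmod (u n - L) \<le> 2 * exp 2" using u(2)[of n] by linarith
    then have "cmod (u n) \<le> cmod L + 2 * exp 2"
      using norm_triangle_ineq[of "u n - L" L] by simp
    then show ?thesis
      by (simp add: u(1) norm_mult norm_power norm_divide divide_right_mono del: of_nat_Suc)
  qed
  have "cmod (\<Sum>m<n. summand m z - L * (of_real (1 / real (Suc m)) * \<i> ^ b m))
      \<le> of_nat (card {..<n}) * (2 * exp 2 * exp (- (real n / 2)))"
    by (rule order.trans[OF norm_sum sum_bounded_above]) (use old in auto)
  then have olds: "cmod (\<Sum>m<n. summand m z - L * (of_real (1 / real (Suc m)) * \<i> ^ b m))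
      \<le> real n * (2 * exp 2 * exp (- (real n / 2)))"
    by (simp only: card_lessThan)
  have tail: "cmod (lsum z - (\<Sum>m<Suc n. summand m z)) \<le> 3 * (1 / 2) ^ n"
    using lsum_tail r(2) by (simp add: z)
  have "lsum z - L * (\<Sum>m<n. of_real (1 / real (Suc m)) * \<i> ^ b m) =
      (\<Sum>m<n. summand m z - L * (of_real (1 / real (Suc m)) * \<i> ^ b m)) + summand n z +
      (lsum z - (\<Sum>m<Suc n. summand m z))"
    by (simp add: sum_subtractf sum_distrib_left)
  also have "cmod \<dots> \<le> ray_error n"
    unfolding ray_error_def by (intro norm_triangle_mono olds current tail)
  finally show ?thesis by (simp only: z_def)
qed

text \<open>The index of the annulus between \<open>R n / 2\<close> and \<open>R (Suc n) / 2\<close>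
  that contains \<open>r\<close>. Radii below \<open>R 0 / 2\<close> also receive level 0, hence the
  assumption of \<open>R_level_le\<close>.\<close>

definition level :: "real \<Rightarrow> nat" where
  "level r = (LEAST n. r < R (Suc n) / 2)"

lemma less_R_level: "r < R (Suc (level r)) / 2"
  unfolding level_def
proof (rule LeastI_ex)
  obtain k where "r < real k" using reals_Archimedean2 by blast
  then show "\<exists>n. r < R (Suc n) / 2" using R_ge[of "Suc k"] by (intro exI[of _ k]) simp
qed

lemma R_level_le:
  assumes "R 0 / 2 \<le> r"
  shows "R (level r) / 2 \<le> r"
proof (cases "level r")
  case (Suc k)
  then have "\<not> r < R (Suc k) / 2" using not_less_Least[of k "\<lambda>n. r < R (Suc n) / 2"]
    by (simp add: level_def)
  then show ?thesis by (simp add: Suc)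
qed (use assms in simp)

lemma filterlim_level: "filterlim level sequentially at_top"
  unfolding filterlim_at_top
proof
  fix k
  show "\<forall>\<^sub>F r in at_top. k \<le> level r"
    using eventually_ge_at_top[of "R k / 2"]
  proof eventually_elim
    case (elim r)
    then have "R k < R (Suc (level r))" using less_R_level[of r] by linarith
    then show ?case using strict_mono_R by (simp add: strict_mono_less)
  qed
qed

lemma lsum_ray_tendsto:
  assumes "\<And>n. b n \<le> 3"
  shows "((\<lambda>r. lsum (of_real r * cis (pi / 2 * digit_tail b 0)) -
      L * (\<Sum>m<level r. of_real (1 / real (Suc m)) * \<i> ^ b m)) \<longlongrightarrow> 0) at_top"
proof (rule Lim_null_comparison)
  show "((\<lambda>r. ray_error (level r)) \<longlongrightarrow> 0) at_top"
    using filterlim_compose[OF ray_error_tendsto filterlim_level] .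
  show "\<forall>\<^sub>F r in at_top. cmod (lsum (of_real r * cis (pi / 2 * digit_tail b 0)) -
      L * (\<Sum>m<level r. of_real (1 / real (Suc m)) * \<i> ^ b m)) \<le> ray_error (level r)"
    using eventually_ge_at_top[of "R 0 / 2"]
  proof eventually_elim
    case (elim r)
    then show ?case
      using R_level_le less_R_level[of r] by (intro ray_approximation assms) auto
  qed
qed

section \<open>Finite and infinite asymptotic values\<close>

lemma asymptotic_value_lsum: "asymptotic_value lsum w"
proof -
  \<comment> \<open>The target is divided by \<open>L\<close> because the sum on the ray follows
    \<open>L\<close> times the partial sums.\<close>
  obtain b where b: "\<And>n. b n \<le> 3"
    "(\<lambda>N. \<Sum>n<N. of_real (1 / real (Suc n)) * \<i> ^ b n) \<longlonglongrightarrow> w / L"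
    using fourth_root_sum_tendsto by metis
  have "((\<lambda>r. L * (\<Sum>m<level r. of_real (1 / real (Suc m)) * \<i> ^ b m)) \<longlongrightarrow> L * (w / L)) at_top"
    by (intro tendsto_intros filterlim_compose[OF b(2) filterlim_level])
  from tendsto_add[OF lsum_ray_tendsto[of b, OF b(1)] this]
  have "((\<lambda>r. lsum (of_real r * cis (pi / 2 * digit_tail b 0))) \<longlongrightarrow> w) at_top"
    using L_nonzero by simp
  then show ?thesis
    unfolding asymptotic_value_def using path_to_infinity_ray by blast
qed

text \<open>With all digits 0 the ray is the positive axis and the partial sums are harmonic. This
  also provides the lower bound for the maximum modulus.\<close>

lemma lsum_at_infinity: "filterlim (\<lambda>r. lsum (of_real r)) at_infinity at_top"
proof -
  have partial: "cmod (\<Sum>n<N. of_real (1 / real (Suc n)) * \<i> ^ (0::nat)) = (\<Sum>n<N. 1 / real (Suc n))" for N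
    unfolding power_0 mult_1_right of_real_sum[symmetric] norm_of_real
    by (intro abs_of_nonneg sum_nonneg) simp
  have "filterlim (\<lambda>N. \<Sum>n<N. 1 / real (Suc n)) at_top sequentially"
    by (intro filterlim_sum_at_top not_summable_inverse_Suc) simp
  then have "filterlim (\<lambda>N. cmod L * (\<Sum>n<N. 1 / real (Suc n))) at_top sequentially"
    using L_nonzero by (intro filterlim_tendsto_pos_mult_at_top[OF tendsto_const]) auto
  also have "(\<lambda>N. cmod L * (\<Sum>n<N. 1 / real (Suc n))) =
      (\<lambda>N. cmod (L * (\<Sum>n<N. of_real (1 / real (Suc n)) * \<i> ^ (0::nat))))"
    by (simp only: norm_mult partial)
  finally have "filterlim (\<lambda>N. L * (\<Sum>n<N. of_real (1 / real (Suc n)) * \<i> ^ (0::nat)))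
      at_infinity sequentially"
    by (rule filterlim_norm_at_top_imp_at_infinity)
  from tendsto_add_filterlim_at_infinity[OF lsum_ray_tendsto[of "\<lambda>_. 0"]
      filterlim_compose[OF this filterlim_level]]
  show ?thesis by (simp add: digit_tail_def)
qed

lemma asymptotic_value_infinity_lsum: "asymptotic_value_infinity lsum"
  unfolding asymptotic_value_infinity_def
  using path_to_infinity_ray[of 0] lsum_at_infinity by (intro exI[of _ of_real]) simp

section \<open>Growth of the maximum modulus\<close>

text \<open>The lower bound \<open>1\<close> matters because \<^term>\<open>ln (x::real)\<close> is \<open>ln \<bar>x\<bar>\<close> for negative \<open>x\<close>.\<close>
lemma eventually_max_modulus_ge_1: "eventually (\<lambda>r. 1 \<le> max_modulus lsum r) at_top"
  using lsum_at_infinity[THEN filterlim_at_infinity_imp_norm_at_top, unfolded filterlim_at_top, rule_format, of 1]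
    eventually_ge_at_top[of 0]
proof eventually_elim
  case (elim r)
  have "compact ((\<lambda>z. cmod (lsum z)) ` sphere 0 r)"
    using holomorphic_lsum
    by (intro compact_continuous_image continuous_intros)
      (auto intro: holomorphic_on_imp_continuous_on holomorphic_on_subset)
  then have "cmod (lsum (of_real r)) \<le> max_modulus lsum r"
    unfolding max_modulus_def using elim
    by (intro cSUP_upper) (auto intro: bounded_imp_bdd_above compact_imp_bounded)
  then show ?case using elim by linarith
qed

lemma max_modulus_le:
  assumes "R 0 / 2 \<le> r"
  shows "max_modulus lsum r \<le> exp (r ^ (4 * 100 ^ level r + 1))"
  unfolding max_modulus_def
proof (rule cSUP_least)
  show "sphere 0 r \<noteq> ({} :: complex set)" using assms R_pos[of 0] by auto
  show "cmod (lsum z) \<le> exp (r ^ (4 * 100 ^ level r + 1))" if "z \<in> sphere 0 r" for z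
    using lsum_growth[of "level r" z] R_level_le[OF assms] less_R_level[of r] that by simp
qed

lemma ln_ln_max_modulus_le:
  "eventually (\<lambda>r. ln (ln (max_modulus lsum r)) \<le> (4 * 100 ^ level r + 1) * ln r) at_top"
  using eventually_max_modulus_ge_1 eventually_ge_at_top[of "R 0 / 2"]
proof eventually_elim
  case (elim r)
  define M where "M = max_modulus lsum r"
  define k :: nat where "k = 4 * 100 ^ level r + 1"
  have r: "r > 1" using elim(2) R_ge[of 0] by simp
  have "ln M \<le> ln (exp (r ^ k))"
    using elim max_modulus_le[of r] by (intro ln_mono) (auto simp: M_def k_def)
  then have "ln M \<le> r ^ k" by simp
  moreover have "ln M \<ge> 0" using elim by (simp add: M_def)
  \<comment> \<open>If \<open>ln M = 0\<close>, the left side is \<open>ln 0 = 0\<close> by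
    convention, and the right side is nonnegative because \<open>r > 1\<close>.\<close>
  ultimately have "ln (ln M) \<le> ln (r ^ k)"
    using r by (cases "ln M = 0") (auto intro!: ln_mono)
  also have "\<dots> = real k * ln r" using r by (simp add: ln_realpow)
  finally show ?case by (simp add: M_def k_def add.commute)
qed

end

section \<open>Choice of the radii for the given growth function\<close>

theorem theorem1:
  fixes G :: "real \<Rightarrow> real"
  assumes "continuous_on {0..} G"
    and "strict_mono_on {0..} G"
    and "\<forall>r\<ge>0. G r > 0"
    and "filterlim G at_top at_top"
  shows "\<exists>\<phi> R0. \<phi> holomorphic_on UNIV \<and> R0 > 0 \<and>
           (\<forall>r>R0. ln (ln (max_modulus \<phi> r)) < G r * ln r) \<and>
           (\<forall>w. asymptotic_value \<phi> w) \<and> asymptotic_value_infinity \<phi>"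
proof -
  obtain F where "quartic_primitive F" using quartic_primitive_exists by blast
  then interpret quartic_primitive F .
  obtain L where L: "L \<noteq> 0"
    "\<And>z. \<bar>Im z\<bar> \<le> Re z / 4 \<Longrightarrow> cmod (F z - L) \<le> 2 * exp 2 * exp (- Re z)"
    using sector_limit by blast
  \<comment> \<open>One more than the exponent \<open>4 * 100 ^ n + 1\<close> of the growth bound,
    so that the final inequality is strict.\<close>
  have "\<forall>n::nat. \<exists>h. \<forall>r\<ge>h. G r \<ge> 4 * 100 ^ n + 2"
    using assms(4) by (simp add: filterlim_at_top eventually_at_top_linorder)
  then obtain H where H: "\<And>(n::nat) r. r \<ge> H n \<Longrightarrow> G r \<ge> 4 * 100 ^ n + 2"
    by metis
  \<comment> \<open>The \<open>n\<close>-th annulus starts at \<open>R n / 2\<close>, so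
    \<open>R n \<ge> 2 * H n\<close> makes the lower bound for \<open>G\<close> valid on all of
    it.\<close>
  have "\<exists>R. \<forall>n. (R n \<ge> 2 * (real n + 6) \<and> R n \<ge> 2 * H n) \<and> R (Suc n) \<ge> 2 * real (Suc n) * R n"
  proof (rule dependent_nat_choice)
    show "\<exists>x. x \<ge> 2 * (real 0 + 6) \<and> x \<ge> 2 * H 0"
      by (meson max.cobounded1 max.cobounded2)
    show "\<exists>y. (y \<ge> 2 * (real (Suc n) + 6) \<and> y \<ge> 2 * H (Suc n)) \<and> y \<ge> 2 * real (Suc n) * x" for x n
      by (meson max.cobounded1 max.cobounded2 order.trans)
  qed
  then obtain R where R: "\<And>n. R n \<ge> 2 * (real n + 6)" "\<And>n. R n \<ge> 2 * H n"
    "\<And>n. R (Suc n) \<ge> 2 * real (Suc n) * R n"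
    by blast
  interpret lacunary_sum F L R
    by standard (use L R in auto)
  have "eventually (\<lambda>r. ln (ln (max_modulus lsum r)) < G r * ln r) at_top"
    using ln_ln_max_modulus_le eventually_ge_at_top[of "R 0 / 2"]
  proof eventually_elim
    case (elim r)
    have r: "r > 1" using elim(2) R(1)[of 0] by simp
    have "H (level r) \<le> r" using R(2)[of "level r"] R_level_le[OF elim(2)] by simp
    then have "4 * 100 ^ level r + 1 < G r" using H[of "level r" r] by simp
    then have "(4 * 100 ^ level r + 1) * ln r < G r * ln r"
      using r by (intro mult_strict_right_mono) auto
    with elim(1) show ?case by (rule le_less_trans)
  qed
  then obtain r0 where r0: "\<And>r. r \<ge> r0 \<Longrightarrow> ln (ln (max_modulus lsum r)) < G r * ln r"
    by (auto simp: eventually_at_top_linorder)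
  have "\<forall>r>max r0 1. ln (ln (max_modulus lsum r)) < G r * ln r"
    using r0 by simp
  then show ?thesis
    using holomorphic_lsum asymptotic_value_lsum asymptotic_value_infinity_lsum
    by (intro exI[of _ lsum] exI[of _ "max r0 1"]) auto
qed

end
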